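(* Let $\mathcal{H}_u$ be a separable Hilbert space, let $H:\mathcal{H}_u\to\mathbb{R}^{N_d}$ be a bounded linear operator, and let $H^*H$ be a Hilbert–Schmidt operator on $\mathcal{H}_u$. Let $\Gamma_{\mathrm{noise}}=\tau^{-1}\mathbf{I}$ with $\tau>0$, let $\mathcal{C}_0$ be a positive definite, symmetric, trace-class operator on $\mathcal{H}_u$, let $\lambda^*\in\mathbb{R}$ and $\mathcal{C}_\lambda\ge 0$ be real numbers, and let $\mathcal{C}_v$ be the operator with $$\mathcal{C}_v^{-1}=(\mathcal{C}_\lambda+(\lambda^* )^2)H^*\Gamma_{\mathrm{noise}}^{-1}H+\mathcal{C}_0^{-1}.$$ Then $$\mathrm{Tr}\big(\mathcal{C}_vH^*\Gamma_{\mathrm{noise}}^{-1}H\big)=\mathrm{Tr}\Big(\big((\mathcal{C}_\lambda+(\lambda^* )^2)\,\mathcal{C}_0^{1/2}H^*\Gamma_{\mathrm{noise}}^{-1}H\mathcal{C}_0^{1/2}+\mathrm{Id}\big)^{-1}\mathcal{C}_0^{1/2}H^*\Gamma_{\mathrm{noise}}^{-1}H\mathcal{C}_0^{1/2}\Big)<\infty.$$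
   Context: $H^*$ is the adjoint of $H$, $\mathrm{Id}$ the identity on $\mathcal{H}_u$, and $\mathrm{Tr}$ the operator trace. $\mathcal{C}_0^{-1}$ is the (in general unbounded, densely defined) inverse of $\mathcal{C}_0$; equivalently, $\mathcal{C}_v=\mathcal{C}_0^{1/2}\big((\mathcal{C}_\lambda+(\lambda^* )^2)\mathcal{C}_0^{1/2}H^*\Gamma_{\mathrm{noise}}^{-1}H\mathcal{C}_0^{1/2}+\mathrm{Id}\big)^{-1}\mathcal{C}_0^{1/2}$. In the paper $\lambda^*$ and $\mathcal{C}_\lambda$ are the mean and variance of a probability measure $\nu^\lambda$ on $\mathbb{R}$, and $\mathcal{C}_v$ is the covariance operator of the Gaussian approximate posterior of $v$. *)

theory Defs
  imports "HOL-Analysis.Analysis"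
begin

section \<open>Bounded operators on a real Hilbert space\<close>

text \<open>The Hilbert space is a type of class \<open>{real_inner, complete_space}\<close>; bounded operators are
  functions satisfying \<^const>\<open>bounded_linear\<close>, and adjoints are given by \<^const>\<open>adjoint\<close>.\<close>

definition symmetric_op :: "('a::real_inner \<Rightarrow> 'a) \<Rightarrow> bool" where
  "symmetric_op A \<longleftrightarrow> (\<forall>x y. A x \<bullet> y = x \<bullet> A y)"

definition positive_op :: "('a::real_inner \<Rightarrow> 'a) \<Rightarrow> bool" where
  "positive_op A \<longleftrightarrow> bounded_linear A \<and> symmetric_op A \<and> (\<forall>x. 0 \<le> A x \<bullet> x)"

definition positive_definite_op :: "('a::real_inner \<Rightarrow> 'a) \<Rightarrow> bool" where
  "positive_definite_op A \<longleftrightarrow> (\<forall>x. x \<noteq> 0 \<longrightarrow> 0 < A x \<bullet> x)"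

text \<open>The square root of a positive operator on a Hilbert space: its unique positive root.\<close>

definition sqrt_op :: "('a::real_inner \<Rightarrow> 'a) \<Rightarrow> 'a \<Rightarrow> 'a" where
  "sqrt_op A = (THE S. positive_op S \<and> S \<circ> S = A)"

definition abs_op :: "('a::real_inner \<Rightarrow> 'a) \<Rightarrow> 'a \<Rightarrow> 'a" where
  "abs_op A = sqrt_op (adjoint A \<circ> A)"

definition orthonormal_basis :: "'a::real_inner set \<Rightarrow> bool" where
  "orthonormal_basis B \<longleftrightarrow>
     pairwise orthogonal B \<and> (\<forall>e\<in>B. norm e = 1) \<and> closure (span B) = UNIV"

text \<open>The sums of nonnegative terms in the next two definitions do not depend on the basis,
  so \<open>for some basis\<close> and \<open>for every basis\<close> are equivalent.\<close>

definition hilbert_schmidt :: "('a::real_inner \<Rightarrow> 'a) \<Rightarrow> bool" where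
  "hilbert_schmidt A \<longleftrightarrow> bounded_linear A \<and>
     (\<exists>B. orthonormal_basis B \<and> (\<lambda>e. (norm (A e))\<^sup>2) summable_on B)"

definition trace_class :: "('a::real_inner \<Rightarrow> 'a) \<Rightarrow> bool" where
  "trace_class A \<longleftrightarrow> bounded_linear A \<and>
     (\<exists>B. orthonormal_basis B \<and> (\<lambda>e. abs_op A e \<bullet> e) summable_on B)"

text \<open>The trace is the common value, over all orthonormal bases, of the sum of the diagonal
  entries; it is meaningful when \<open>A\<close> is trace class.\<close>

definition trace_op :: "('a::real_inner \<Rightarrow> 'a) \<Rightarrow> real" where
  "trace_op A = (THE t. \<forall>B. orthonormal_basis B \<longrightarrow> ((\<lambda>e. A e \<bullet> e) has_sum t) B)"

section \<open>Possibly unbounded operators\<close>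

text \<open>An operator that is only defined on a subspace is a partial function whose \<^const>\<open>dom\<close> is its
  domain. Equality of such operators thus means equality of domains and of values.\<close>

text \<open>The inverse of an injective operator \<open>T\<close>, with domain \<^term>\<open>range T\<close>.\<close>

definition inverse_op :: "('a \<Rightarrow> 'b) \<Rightarrow> 'b \<rightharpoonup> 'a" where
  "inverse_op T = (\<lambda>y. if y \<in> range T then Some (inv T y) else None)"

text \<open>The sum of an everywhere defined operator and a partially defined one, with the domain
  of the latter.\<close>

definition add_op :: "('a \<Rightarrow> 'b::plus) \<Rightarrow> ('a \<rightharpoonup> 'b) \<Rightarrow> ('a \<rightharpoonup> 'b)" where
  "add_op A T = (\<lambda>x. map_option (\<lambda>y. A x + y) (T x))"

section \<open>The data misfit operator\<close>

text \<open>The operator \<open>H\<^sup>* \<Gamma>\<^sup>-\<^sup>1 H\<close>.\<close>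

definition misfit_op :: "('a::real_inner \<Rightarrow> real ^ 'd) \<Rightarrow> real ^ 'd ^ 'd \<Rightarrow> 'a \<Rightarrow> 'a" where
  "misfit_op H \<Gamma> = adjoint H \<circ> (\<lambda>y. matrix_inv \<Gamma> *v y) \<circ> H"

end

theory Submission
  imports Defs
begin

text \<open>Since \<open>H\<close> takes values in a finite-dimensional space, \<open>M = H\<^sup>* \<Gamma>\<^sup>-\<^sup>1 H\<close> has finite rank,
  \<open>M x = \<tau> \<Sum>\<^sub>b \<langle>x, h\<^sub>b\<rangle> h\<^sub>b\<close> with \<open>h\<^sub>b = H\<^sup>* b\<close>, and so have both operators whose traces are compared.
  By Parseval the trace of \<open>x \<mapsto> \<Sum>\<^sub>i \<langle>x, u\<^sub>i\<rangle> v\<^sub>i\<close> is \<open>\<Sum>\<^sub>i \<langle>u\<^sub>i, v\<^sub>i\<rangle>\<close> in every orthonormal basis. With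
  \<open>Q = C\<^sub>0\<^sup>1\<^sup>/\<^sup>2\<close>, \<open>R = (a Q M Q + Id)\<^sup>-\<^sup>1\<close> and \<open>C\<^sub>v = Q R Q\<close>, the two traces are
  \<open>\<tau> \<Sum>\<^sub>b \<langle>h\<^sub>b, Q R Q h\<^sub>b\<rangle>\<close> and \<open>\<tau> \<Sum>\<^sub>b \<langle>Q h\<^sub>b, R Q h\<^sub>b\<rangle>\<close>, which agree because \<open>Q\<close> is symmetric.\<close>

section \<open>Adjoints on Hilbert spaces\<close>

text \<open>For \<open>c > 0\<close> the bound is the value at the minimiser
  \<open>t = - b / c\<close>. For \<open>c = 0\<close> an affine function of \<open>t\<close> stays
  nonnegative only if \<open>b = 0\<close>; this degenerate case covers forms that vanish on nonzero
  vectors.\<close>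

lemma nonneg_quadratic_discriminant:
  fixes a b c :: real
  assumes q: "\<And>t. 0 \<le> a + 2 * t * b + t\<^sup>2 * c" and "0 \<le> c"
  shows "b\<^sup>2 \<le> a * c"
proof (cases "c = 0")
  case True
  have "b = 0"
  proof (rule ccontr)
    assume "b \<noteq> 0"
    then have "a + 2 * (- (a + 1) / (2 * b)) * b = -1"
      by (simp add: field_simps)
    with q[of "- (a + 1) / (2 * b)"] True show False
      by simp
  qed
  then show ?thesis
    using True by simp
next
  case False
  with \<open>0 \<le> c\<close> have "0 < c" by simp
  have "0 \<le> a + 2 * (- b / c) * b + (- b / c)\<^sup>2 * c"
    by (rule q)
  also have "\<dots> = a - b\<^sup>2 / c"
    using \<open>0 < c\<close> by (simp add: field_simps power2_eq_square)
  finally show ?thesis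
    using \<open>0 < c\<close> by (simp add: field_simps)
qed

text \<open>Direct method: the functional \<open>\<phi>\<close> is bounded below, the parallelogram
  identity makes a minimising sequence Cauchy, and at its limit the first variation,
  \<open>x \<bullet> z - f x\<close> up to a factor, vanishes.\<close>

theorem Riesz_representation:
  fixes f :: "'a::{real_inner, complete_space} \<Rightarrow> real"
  assumes f: "bounded_linear f"
  obtains z where "\<And>x. f x = x \<bullet> z"
proof -
  interpret f: bounded_linear f by (rule f)
  \<comment> \<open>The representing vector is the minimiser of \<open>\<phi>\<close>.\<close>
  define \<phi> where "\<phi> x = x \<bullet> x - 2 * f x" for x
  obtain K where K: "\<And>x. norm (f x) \<le> norm x * K"
    using f.bounded by blast
  have "- (K\<^sup>2) \<le> \<phi> x" for x
  proof -
    have "0 \<le> (norm x - K)\<^sup>2" by simp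
    moreover have "f x \<le> norm x * K" using K[of x] by simp
    ultimately show ?thesis
      by (simp add: \<phi>_def power2_norm_eq_inner[symmetric] power2_diff)
  qed
  then have bdd: "bdd_below (range \<phi>)"
    by (intro bdd_belowI[of _ "- (K\<^sup>2)"]) auto
  define m where "m = Inf (range \<phi>)"
  have m: "m \<le> \<phi> x" for x
    unfolding m_def using bdd by (auto intro: cInf_lower)
  have "\<exists>x. \<phi> x < m + inverse (real (Suc n))" for n
  proof -
    have "Inf (range \<phi>) < m + inverse (real (Suc n))"
      by (simp add: m_def)
    from cInf_lessD[OF _ this] show ?thesis by auto
  qed
  then obtain X where X: "\<And>n. \<phi> (X n) < m + inverse (real (Suc n))"
    by metis
  \<comment> \<open>In the parallelogram identity the linear parts of \<open>\<phi>\<close> cancel,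
    and the midpoint has value at least \<open>m\<close>. Each excess over \<open>m\<close> counts
    twice, whence the threshold \<open>e\<^sup>2 / 4\<close> below.\<close>
  have parallelogram: "(dist x y)\<^sup>2 \<le> 2 * (\<phi> x - m) + 2 * (\<phi> y - m)" for x y
  proof -
    have "(dist x y)\<^sup>2 = 2 * \<phi> x + 2 * \<phi> y - 4 * \<phi> ((1/2) *\<^sub>R (x + y))"
      unfolding dist_norm power2_norm_eq_inner \<phi>_def f.scaleR f.add
      by (simp add: inner_simps inner_commute algebra_simps)
    with m[of "(1/2) *\<^sub>R (x + y)"] show ?thesis by simp
  qed
  have "Cauchy X"
  proof (rule metric_CauchyI)
    fix e :: real assume "0 < e"
    then obtain N where N: "inverse (real (Suc N)) < e\<^sup>2 / 4"
      using reals_Archimedean[of "e\<^sup>2 / 4"] by auto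
    have near: "\<phi> (X n) - m < e\<^sup>2 / 4" if "N \<le> n" for n
    proof -
      have "inverse (real (Suc n)) \<le> inverse (real (Suc N))"
        using that by (intro le_imp_inverse_le) auto
      with X[of n] N show ?thesis by linarith
    qed
    have "dist (X i) (X j) < e" if "N \<le> i" "N \<le> j" for i j
    proof -
      have "(dist (X i) (X j))\<^sup>2 < e\<^sup>2"
        using parallelogram[of "X i" "X j"] near[OF that(1)] near[OF that(2)] by argo
      then show ?thesis
        using \<open>0 < e\<close> by (simp add: power2_less_imp_less)
    qed
    then show "\<exists>M. \<forall>i\<ge>M. \<forall>j\<ge>M. dist (X i) (X j) < e" by blast
  qed
  then obtain z where z: "X \<longlonglongrightarrow> z"
    using Cauchy_convergent convergent_def by blast
  have "(\<lambda>n. \<phi> (X n)) \<longlonglongrightarrow> \<phi> z"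
    unfolding \<phi>_def by (intro tendsto_intros f.tendsto z)
  moreover have "(\<lambda>n. m + inverse (real (Suc n))) \<longlonglongrightarrow> m + 0"
    by (intro tendsto_intros LIMSEQ_inverse_real_of_nat)
  ultimately have "\<phi> z \<le> m + 0"
    by (rule LIMSEQ_le) (use X in \<open>auto intro: less_imp_le\<close>)
  have "f x = x \<bullet> z" for x
  proof -
    \<comment> \<open>The constant term is written as 0 so that the discriminant bound reads
      \<open>b\<^sup>2 \<le> 0\<close>.\<close>
    have "0 \<le> 0 + 2 * t * (x \<bullet> z - f x) + t\<^sup>2 * (x \<bullet> x)" for t
    proof -
      have "\<phi> (z + t *\<^sub>R x) = \<phi> z + 2 * t * (x \<bullet> z - f x) + t\<^sup>2 * (x \<bullet> x)"
        unfolding \<phi>_def f.add f.scaleR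
        by (simp add: inner_simps inner_commute algebra_simps power2_eq_square)
      with m[of "z + t *\<^sub>R x"] \<open>\<phi> z \<le> m + 0\<close> show ?thesis by linarith
    qed
    from nonneg_quadratic_discriminant[OF this] show ?thesis by simp
  qed
  then show ?thesis by (rule that)
qed

text \<open>\<open>adjoint\<close> is a choice operator, so its characteristic equation needs an
  existing witness. Riesz representation of \<open>x \<mapsto> f x \<bullet> y\<close> provides it
  for each \<open>y\<close>.\<close>

lemma inner_adjoint:
  fixes f :: "'a::{real_inner, complete_space} \<Rightarrow> 'b::real_inner"
  assumes f: "bounded_linear f"
  shows "x \<bullet> adjoint f y = f x \<bullet> y"
proof -
  have "\<exists>z. \<forall>x. f x \<bullet> y = x \<bullet> z" for y
    using Riesz_representation[OF bounded_linear_inner_left_comp[OF f, of y]] by metis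
  then have "\<exists>g. \<forall>x y. f x \<bullet> y = x \<bullet> g y"
    by metis
  then have "\<forall>x y. f x \<bullet> y = x \<bullet> adjoint f y"
    unfolding adjoint_def by (rule someI_ex)
  then show ?thesis by simp
qed

lemma bounded_linear_adjoint:
  fixes f :: "'a::{real_inner, complete_space} \<Rightarrow> 'b::real_inner"
  assumes f: "bounded_linear f"
  shows "bounded_linear (adjoint f)"
proof -
  obtain K where K: "\<And>x. norm (f x) \<le> norm x * K" and "0 \<le> K"
    using bounded_linear.nonneg_bounded[OF f] by blast
  show ?thesis
  proof (rule bounded_linear_intro)
    show "adjoint f (x + y) = adjoint f x + adjoint f y" for x y
      by (rule vector_eq_ldot[THEN iffD1]) (simp add: inner_adjoint[OF f] inner_simps)
    show "adjoint f (r *\<^sub>R x) = r *\<^sub>R adjoint f x" for r x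
      by (rule vector_eq_ldot[THEN iffD1]) (simp add: inner_adjoint[OF f] inner_simps)
    show "norm (adjoint f y) \<le> norm y * K" for y
    proof (cases "adjoint f y = 0")
      case False
      have "norm (adjoint f y) * norm (adjoint f y) = f (adjoint f y) \<bullet> y"
        by (simp add: inner_adjoint[OF f, symmetric] norm_eq_sqrt_inner)
      also have "\<dots> \<le> norm (f (adjoint f y)) * norm y"
        by (rule norm_cauchy_schwarz)
      also have "\<dots> \<le> norm (adjoint f y) * (norm y * K)"
        using mult_right_mono[OF K norm_ge_zero, of "adjoint f y" y] by (simp add: mult_ac)
      finally show ?thesis
        using False by simp
    qed (use \<open>0 \<le> K\<close> in simp)
  qed
qed

lemma positive_op_adjoint_comp:
  fixes f :: "'a::{real_inner, complete_space} \<Rightarrow> 'a"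
  assumes f: "bounded_linear f"
  shows "positive_op (adjoint f \<circ> f)"
proof -
  have "(adjoint f \<circ> f) x \<bullet> y = f x \<bullet> f y" for x y
    by (simp add: inner_commute[of "adjoint f _"] inner_adjoint[OF f] inner_commute)
  moreover have "x \<bullet> (adjoint f \<circ> f) y = f x \<bullet> f y" for x y
    by (simp add: inner_adjoint[OF f])
  ultimately show ?thesis
    unfolding positive_op_def symmetric_op_def
    using bounded_linear_compose[OF bounded_linear_adjoint[OF f] f] by (simp add: o_def)
qed

text \<open>The usual discriminant argument for the semi-inner product
  \<open>T x \<bullet> y\<close>.\<close>

lemma positive_op_cauchy_schwarz:
  assumes T: "positive_op T"
  shows "(T x \<bullet> y)\<^sup>2 \<le> (T x \<bullet> x) * (T y \<bullet> y)"
proof (rule nonneg_quadratic_discriminant)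
  interpret T: bounded_linear T
    using T by (simp add: positive_op_def)
  have sym: "T y \<bullet> x = T x \<bullet> y"
    using T by (simp add: positive_op_def symmetric_op_def inner_commute)
  have "0 \<le> T (x + t *\<^sub>R y) \<bullet> (x + t *\<^sub>R y)" for t
    using T by (simp add: positive_op_def)
  then show "0 \<le> T x \<bullet> x + 2 * t * (T x \<bullet> y) + t\<^sup>2 * (T y \<bullet> y)" for t
    by (simp add: T.add T.scaleR inner_simps sym power2_eq_square algebra_simps)
  show "0 \<le> T y \<bullet> y"
    using T by (simp add: positive_op_def)
qed

lemma positive_op_eq_0:
  assumes T: "positive_op T" and "T x \<bullet> x = 0"
  shows "T x = 0"
  using positive_op_cauchy_schwarz[OF T, of x "T x"] assms(2) by simp

text \<open>Cauchy-Schwarz for the form of \<open>T\<close> at the pair \<open>x\<close>,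
  \<open>T x\<close> turns a bound on the quadratic form into a bound on the norm.\<close>

lemma positive_op_contraction:
  assumes T: "positive_op T" and le: "\<And>x. T x \<bullet> x \<le> x \<bullet> x"
  shows "norm (T x) \<le> norm x"
proof -
  have "(T x \<bullet> T x)\<^sup>2 \<le> (T x \<bullet> x) * (T (T x) \<bullet> T x)"
    by (rule positive_op_cauchy_schwarz[OF T])
  also have "\<dots> \<le> (x \<bullet> x) * (T x \<bullet> T x)"
    using T by (intro mult_mono le) (simp_all add: positive_op_def)
  finally have "T x \<bullet> T x \<le> x \<bullet> x \<or> T x = 0"
    by (auto simp: power2_eq_square dest: mult_right_le_imp_le)
  then show ?thesis
    by (auto simp: norm_le)
qed

section \<open>Square roots of positive operators\<close>

text \<open>The limit \<open>Y\<close> of \<open>sqrt_iter B\<close> satisfies \<open>2 Y = B + Y\<^sup>2\<close>, that is, \<open>(Id - Y)\<^sup>2 = Id - B\<close>. If \<open>B\<close> is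
  a contraction, the increments are dominated by those of the scalar iteration for \<open>B = 1\<close>.\<close>

primrec sqrt_iter :: "('a::real_vector \<Rightarrow> 'a) \<Rightarrow> nat \<Rightarrow> 'a \<Rightarrow> 'a" where
  "sqrt_iter B 0 = (\<lambda>x. 0)"
| "sqrt_iter B (Suc n) = (\<lambda>x. (1/2) *\<^sub>R (B x + sqrt_iter B n (sqrt_iter B n x)))"

primrec sqrt_iter_bound :: "nat \<Rightarrow> real" where
  "sqrt_iter_bound 0 = 0"
| "sqrt_iter_bound (Suc n) = (1 + (sqrt_iter_bound n)\<^sup>2) / 2"

lemma sqrt_iter_bound_range: "0 \<le> sqrt_iter_bound n \<and> sqrt_iter_bound n \<le> 1"
  by (induction n) (auto simp: power_le_one)

lemma linear_sqrt_iter: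
  assumes "linear B"
  shows "linear (sqrt_iter B n)"
proof (induction n)
  case (Suc n)
  then show ?case
    using linear_compose[OF Suc Suc] assms
    by (auto simp: o_def intro!: linear_compose_scale_right linear_compose_add)
qed (simp add: linear_iff)

lemma sqrt_iter_norm:
  assumes "\<And>x. norm (B x) \<le> norm x"
  shows "norm (sqrt_iter B n x) \<le> sqrt_iter_bound n * norm x"
proof (induction n arbitrary: x)
  case (Suc n)
  let ?Y = "sqrt_iter B n" and ?y = "sqrt_iter_bound n"
  have "norm (?Y (?Y x)) \<le> ?y * norm (?Y x)"
    by (rule Suc)
  also have "\<dots> \<le> ?y * (?y * norm x)"
    using sqrt_iter_bound_range by (intro mult_left_mono Suc) auto
  finally have "norm (B x + ?Y (?Y x)) \<le> norm x + ?y * (?y * norm x)"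
    using norm_triangle_ineq[of "B x" "?Y (?Y x)"] assms[of x] by linarith
  then show ?case
    by (simp add: power2_eq_square algebra_simps del: scaleR_add_right)
qed simp

text \<open>For consecutive iterates \<open>Y\<close>, \<open>Z\<close> the identity Z^2 - Y^2 = Z
  (Z - Y) + (Z - Y) Y holds whether or not they commute. Taking norms gives z (z - y) + (z - y) y =
  z^2 - y^2, twice the next scalar increment.\<close>

lemma sqrt_iter_step:
  assumes B: "linear B" "\<And>x. norm (B x) \<le> norm x"
  shows "norm (sqrt_iter B (Suc n) x - sqrt_iter B n x)
    \<le> (sqrt_iter_bound (Suc n) - sqrt_iter_bound n) * norm x"
proof (induction n arbitrary: x)
  case 0
  show ?case using B(2)[of x] by simp
next
  case (Suc n)
  let ?Y = "sqrt_iter B n" and ?y = "sqrt_iter_bound n"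
  let ?Z = "sqrt_iter B (Suc n)" and ?z = "sqrt_iter_bound (Suc n)"
  \<comment> \<open>The scalar increment is (1 - y)^2 / 2.\<close>
  have "?y \<le> ?z"
    using zero_le_power2[of "1 - ?y"] by (simp add: power2_diff)
  have "norm (?Z (?Z x) - ?Y (?Y x)) = norm (?Z (?Z x - ?Y x) + (?Z (?Y x) - ?Y (?Y x)))"
    by (simp only: linear_diff[OF linear_sqrt_iter[OF B(1)]]) simp
  also have "\<dots> \<le> norm (?Z (?Z x - ?Y x)) + norm (?Z (?Y x) - ?Y (?Y x))"
    by (rule norm_triangle_ineq)
  also have "\<dots> \<le> ?z * ((?z - ?y) * norm x) + (?z - ?y) * (?y * norm x)"
  proof (rule add_mono)
    have "norm (?Z (?Z x - ?Y x)) \<le> ?z * norm (?Z x - ?Y x)"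
      by (rule sqrt_iter_norm[OF B(2)])
    also have "\<dots> \<le> ?z * ((?z - ?y) * norm x)"
      using sqrt_iter_bound_range by (intro mult_left_mono Suc) blast
    finally show "norm (?Z (?Z x - ?Y x)) \<le> ?z * ((?z - ?y) * norm x)" .
    have "norm (?Z (?Y x) - ?Y (?Y x)) \<le> (?z - ?y) * norm (?Y x)"
      by (rule Suc)
    also have "\<dots> \<le> (?z - ?y) * (?y * norm x)"
      using \<open>?y \<le> ?z\<close> by (intro mult_left_mono sqrt_iter_norm[OF B(2)]) simp
    finally show "norm (?Z (?Y x) - ?Y (?Y x)) \<le> (?z - ?y) * (?y * norm x)" .
  qed
  also have "\<dots> = (?z\<^sup>2 - ?y\<^sup>2) * norm x"
    by (simp add: power2_eq_square algebra_simps del: sqrt_iter_bound.simps)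
  finally have le: "norm (?Z (?Z x) - ?Y (?Y x)) \<le> (?z\<^sup>2 - ?y\<^sup>2) * norm x" .
  have "sqrt_iter B (Suc (Suc n)) x - ?Z x = (1/2) *\<^sub>R (?Z (?Z x) - ?Y (?Y x))"
    unfolding sqrt_iter.simps(2)[of B "Suc n"]
    unfolding sqrt_iter.simps(2)[of B n] by (simp add: algebra_simps)
  moreover have "sqrt_iter_bound (Suc (Suc n)) - ?z = (?z\<^sup>2 - ?y\<^sup>2) / 2"
    unfolding sqrt_iter_bound.simps(2)[of "Suc n"]
    unfolding sqrt_iter_bound.simps(2)[of n] by (simp add: field_simps)
  ultimately show ?case
    using le by (simp only: norm_scaleR)
qed

lemma sqrt_iter_diff:
  assumes B: "linear B" "\<And>x. norm (B x) \<le> norm x" and "n \<le> m"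
  shows "norm (sqrt_iter B m x - sqrt_iter B n x)
    \<le> (sqrt_iter_bound m - sqrt_iter_bound n) * norm x"
  using \<open>n \<le> m\<close>
proof (induction m rule: dec_induct)
  case (step m)
  have "norm (sqrt_iter B (Suc m) x - sqrt_iter B n x)
    \<le> norm (sqrt_iter B (Suc m) x - sqrt_iter B m x) + norm (sqrt_iter B m x - sqrt_iter B n x)"
    by (rule norm_diff_triangle_le[OF order_refl order_refl])
  with sqrt_iter_step[OF B, of m x] step.IH show ?case
    by (simp add: algebra_simps del: sqrt_iter.simps sqrt_iter_bound.simps)
qed simp

lemma convergent_sqrt_iter_bound: "convergent sqrt_iter_bound"
proof (rule Bseq_monoseq_convergent)
  show "Bseq sqrt_iter_bound"
    using sqrt_iter_bound_range by (intro BseqI[of 1]) auto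
  have "sqrt_iter_bound n \<le> sqrt_iter_bound (Suc n)" for n
    using zero_le_power2[of "1 - sqrt_iter_bound n"] by (simp add: power2_diff)
  then show "monoseq sqrt_iter_bound"
    by (intro incseq_imp_monoseq incseq_SucI)
qed

lemma convergent_sqrt_iter:
  fixes B :: "'a::{real_inner, complete_space} \<Rightarrow> 'a"
  assumes B: "linear B" "\<And>x. norm (B x) \<le> norm x"
  shows "convergent (\<lambda>n. sqrt_iter B n x)"
proof -
  have c: "Cauchy sqrt_iter_bound"
    using convergent_sqrt_iter_bound by (rule convergent_Cauchy)
  have "Cauchy (\<lambda>n. sqrt_iter B n x)"
  proof (rule metric_CauchyI)
    fix e :: real assume "0 < e"
    \<comment> \<open>Adding 1 keeps the denominator positive for \<open>x = 0\<close>.\<close>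
    then have "0 < e / (norm x + 1)"
      by (simp add: add_nonneg_pos)
    then obtain N where N: "\<And>i j. N \<le> i \<Longrightarrow> N \<le> j \<Longrightarrow>
        dist (sqrt_iter_bound i) (sqrt_iter_bound j) < e / (norm x + 1)"
      using metric_CauchyD[OF c] by blast
    have less: "dist (sqrt_iter B i x) (sqrt_iter B j x) < e" if "N \<le> j" "j \<le> i" for i j
    proof -
      have "sqrt_iter_bound i - sqrt_iter_bound j < e / (norm x + 1)"
        using N[of i j] that by (simp add: dist_real_def)
      then have "(sqrt_iter_bound i - sqrt_iter_bound j) * norm x \<le> e / (norm x + 1) * norm x"
        by (intro mult_right_mono) auto
      also have "\<dots> < e"
        using \<open>0 < e\<close> by (simp add: divide_less_eq add_nonneg_pos)
      finally show ?thesis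
        using sqrt_iter_diff[OF B that(2), of x] by (simp add: dist_norm)
    qed
    then have "dist (sqrt_iter B i x) (sqrt_iter B j x) < e" if "N \<le> i" "N \<le> j" for i j
      using that by (metis dist_commute nle_le)
    then show "\<exists>M. \<forall>i\<ge>M. \<forall>j\<ge>M. dist (sqrt_iter B i x) (sqrt_iter B j x) < e"
      by blast
  qed
  then show ?thesis
    by (rule Cauchy_convergent)
qed

text \<open>The iterates are polynomials in \<open>B\<close>. In the limit this gives the
  commutation property on which uniqueness of the square root rests.\<close>

lemma sqrt_iter_commute:
  assumes "linear D" and "\<And>x. D (B x) = B (D x)"
  shows "D (sqrt_iter B n x) = sqrt_iter B n (D x)"
  by (induction n arbitrary: x)
    (simp_all add: linear_0[OF assms(1)] linear_add[OF assms(1)] linear_scale[OF assms(1)] assms(2))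

lemma sqrt_iter_symmetric:
  assumes "symmetric_op B"
  shows "symmetric_op (sqrt_iter B n)"
  using assms unfolding symmetric_op_def
  by (induction n) (simp_all add: inner_simps)

text \<open>The root is \<open>Id - Y\<close> with \<open>Y\<close> the pointwise limit of the
  iterates; it is positive because \<open>Y\<close> is a symmetric contraction.\<close>

theorem contraction_sqrt_exists:
  fixes B :: "'a::{real_inner, complete_space} \<Rightarrow> 'a"
  assumes B: "linear B" "\<And>x. norm (B x) \<le> norm x" and sym: "symmetric_op B"
  obtains S where "positive_op S" and "\<And>x. S (S x) = x - B x"
    and "\<And>D x. bounded_linear D \<Longrightarrow> (\<And>x. D (B x) = B (D x)) \<Longrightarrow> D (S x) = S (D x)"
proof -
  define Y where "Y x = lim (\<lambda>n. sqrt_iter B n x)" for x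
  have lim: "(\<lambda>n. sqrt_iter B n x) \<longlonglongrightarrow> Y x" for x
    using convergent_sqrt_iter[OF B] by (simp add: Y_def convergent_LIMSEQ_iff)
  note lin = linear_sqrt_iter[OF B(1)]
  have iter_le: "norm (sqrt_iter B n x) \<le> norm x" for n x
    using sqrt_iter_norm[of B n x, OF B(2)] sqrt_iter_bound_range[of n]
      mult_right_mono[of "sqrt_iter_bound n" 1 "norm x"] by auto
  have Y_le: "norm (Y x) \<le> norm x" for x
    by (rule Lim_bounded[OF tendsto_norm[OF lim]]) (use iter_le in auto)
  have Y_add: "Y (x + y) = Y x + Y y" for x y
    using tendsto_add[OF lim[of x] lim[of y]] lim[of "x + y"]
    by (simp add: linear_add[OF lin] LIMSEQ_unique)
  have Y_scale: "Y (r *\<^sub>R x) = r *\<^sub>R Y x" for r x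
    using tendsto_scaleR[OF tendsto_const lim[of x], of r] lim[of "r *\<^sub>R x"]
    by (simp add: linear_scale[OF lin] LIMSEQ_unique)
  have Y: "bounded_linear Y"
    by (rule bounded_linear_intro[of _ 1]) (simp_all add: Y_add Y_scale Y_le)
  interpret Y: bounded_linear Y by (rule Y)
  have Y_sym: "Y x \<bullet> y = x \<bullet> Y y" for x y
  proof (rule LIMSEQ_unique)
    show "(\<lambda>n. sqrt_iter B n x \<bullet> y) \<longlonglongrightarrow> Y x \<bullet> y"
      by (intro tendsto_intros lim)
    have "(\<lambda>n. x \<bullet> sqrt_iter B n y) \<longlonglongrightarrow> x \<bullet> Y y"
      by (intro tendsto_intros lim)
    then show "(\<lambda>n. sqrt_iter B n x \<bullet> y) \<longlonglongrightarrow> x \<bullet> Y y"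
      using sqrt_iter_symmetric[OF sym] by (simp add: symmetric_op_def)
  qed
  have Y_eq: "2 *\<^sub>R Y x = B x + Y (Y x)" for x
  proof (rule LIMSEQ_unique)
    show "(\<lambda>n. 2 *\<^sub>R sqrt_iter B (Suc n) x) \<longlonglongrightarrow> 2 *\<^sub>R Y x"
      by (intro tendsto_intros LIMSEQ_Suc[OF lim])
    \<comment> \<open>Operator and argument both vary with \<open>n\<close>. Splitting off
      \<open>sqrt_iter B n (Y x)\<close> leaves a term that tends to 0 because all iterates are
      contractions.\<close>
    have "(\<lambda>n. sqrt_iter B n (sqrt_iter B n x - Y x)) \<longlonglongrightarrow> 0"
    proof (rule Lim_null_comparison)
      show "(\<lambda>n. norm (sqrt_iter B n x - Y x)) \<longlonglongrightarrow> 0"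
        using lim LIM_zero tendsto_norm_zero by blast
    qed (use iter_le in simp)
    from tendsto_add[OF this lim[of "Y x"]]
    have "(\<lambda>n. sqrt_iter B n (sqrt_iter B n x)) \<longlonglongrightarrow> Y (Y x)"
      by (simp add: linear_diff[OF lin])
    from tendsto_add[OF tendsto_const this, of "B x"]
    show "(\<lambda>n. 2 *\<^sub>R sqrt_iter B (Suc n) x) \<longlonglongrightarrow> B x + Y (Y x)"
      by simp
  qed
  show ?thesis
  proof (rule that[of "\<lambda>x. x - Y x"])
    have "Y x \<bullet> x \<le> x \<bullet> x" for x
      using norm_cauchy_schwarz[of "Y x" x] mult_right_mono[OF Y_le norm_ge_zero, of x x]
      by (simp add: power2_norm_eq_inner[symmetric] power2_eq_square)
    then show "positive_op (\<lambda>x. x - Y x)"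
      unfolding positive_op_def symmetric_op_def
      by (auto simp: inner_diff_left inner_diff_right Y_sym
          intro!: bounded_linear_sub bounded_linear_ident Y)
    show "x - Y x - Y (x - Y x) = x - B x" for x
    proof -
      have "x - Y x - Y (x - Y x) = x - 2 *\<^sub>R Y x + Y (Y x)"
        by (simp add: Y.diff scaleR_2 algebra_simps)
      then show ?thesis by (simp add: Y_eq)
    qed
    show "D (x - Y x) = D x - Y (D x)"
      if D: "bounded_linear D" and comm: "\<And>x. D (B x) = B (D x)" for D x
    proof -
      interpret D: bounded_linear D by (rule D)
      have "D (Y x) = Y (D x)"
        using D.tendsto[OF lim[of x]] lim[of "D x"]
        by (simp add: sqrt_iter_commute[of D B, OF D.linear_axioms comm] LIMSEQ_unique)
      then show ?thesis by (simp add: D.diff)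
    qed
  qed
qed

text \<open>Rescaling to \<open>B = Id - T / K\<close> reduces to the contraction case: the norm
  bound on \<open>T\<close> makes \<open>B\<close> positive, and positivity of \<open>T\<close>
  bounds the form of \<open>B\<close> by that of \<open>Id\<close>. The root of
  \<open>Id - B = T / K\<close> is then multiplied by \<open>sqrt K\<close>.\<close>

theorem positive_op_sqrt_exists:
  fixes T :: "'a::{real_inner, complete_space} \<Rightarrow> 'a"
  assumes T: "positive_op T"
  obtains S where "positive_op S" and "S \<circ> S = T"
    and "\<And>D. bounded_linear D \<Longrightarrow> D \<circ> T = T \<circ> D \<Longrightarrow> D \<circ> S = S \<circ> D"
proof -
  interpret T: bounded_linear T
    using T by (simp add: positive_op_def)
  have T_sym: "T x \<bullet> y = x \<bullet> T y" and T_pos: "0 \<le> T x \<bullet> x" for x y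
    using T by (auto simp: positive_op_def symmetric_op_def)
  obtain K where K: "0 < K" "\<And>x. norm (T x) \<le> norm x * K"
    using T.pos_bounded by blast
  define B where "B x = x - (1 / K) *\<^sub>R T x" for x
  have BL: "bounded_linear B"
    unfolding B_def
    by (intro bounded_linear_sub bounded_linear_ident bounded_linear_const_scaleR
        T.bounded_linear_axioms)
  have T_le: "T x \<bullet> x \<le> K * (x \<bullet> x)" for x
    using norm_cauchy_schwarz[of "T x" x] mult_right_mono[OF K(2) norm_ge_zero, of x x]
    by (simp add: power2_norm_eq_inner[symmetric] power2_eq_square mult_ac)
  have B_pos: "positive_op B"
    unfolding positive_op_def symmetric_op_def
    using BL T_le K(1) by (auto simp: B_def inner_simps T_sym field_simps)
  have B_le: "norm (B x) \<le> norm x" for x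
    by (rule positive_op_contraction[OF B_pos])
      (use T_pos K(1) in \<open>auto simp: B_def inner_simps field_simps\<close>)
  obtain S where S: "positive_op S" "\<And>x. S (S x) = x - B x"
    and comm: "\<And>D x. bounded_linear D \<Longrightarrow> (\<And>x. D (B x) = B (D x)) \<Longrightarrow> D (S x) = S (D x)"
    using contraction_sqrt_exists[of B] BL B_le B_pos bounded_linear.linear
    unfolding positive_op_def by blast
  interpret S: bounded_linear S
    using S(1) by (simp add: positive_op_def)
  show ?thesis
  proof (rule that[of "\<lambda>x. sqrt K *\<^sub>R S x"])
    show "positive_op (\<lambda>x. sqrt K *\<^sub>R S x)"
      using S(1) K(1)
      by (auto simp: positive_op_def symmetric_op_def intro!: bounded_linear_const_scaleR)
    show "(\<lambda>x. sqrt K *\<^sub>R S x) \<circ> (\<lambda>x. sqrt K *\<^sub>R S x) = T"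
      using K(1) by (auto simp: fun_eq_iff S.scaleR S(2) B_def)
    show "D \<circ> (\<lambda>x. sqrt K *\<^sub>R S x) = (\<lambda>x. sqrt K *\<^sub>R S x) \<circ> D"
      if D: "bounded_linear D" and "D \<circ> T = T \<circ> D" for D
    proof -
      interpret D: bounded_linear D by (rule D)
      have "D (T x) = T (D x)" for x
        using that(2) by (simp add: fun_eq_iff)
      then have "D (B x) = B (D x)" for x
        by (simp add: B_def D.diff D.scaleR)
      then show ?thesis
        using comm[OF D] by (simp add: fun_eq_iff D.scaleR)
    qed
  qed
qed

text \<open>For y = S x - R x, commutation gives S y + R y = S^2 x - R^2 x = 0. Both forms are
  nonnegative, so both vanish at y, hence S y = R y = 0, and symmetry turns
  \<open>y \<bullet> y\<close> into \<open>x \<bullet> (S y - R y) = 0\<close>.\<close>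

lemma positive_op_sqrt_unique_if_commute:
  assumes S: "positive_op S" and R: "positive_op R"
    and eq: "S \<circ> S = R \<circ> R" and comm: "R \<circ> S = S \<circ> R"
  shows "R = S"
proof
  fix x
  interpret S: bounded_linear S using S by (simp add: positive_op_def)
  interpret R: bounded_linear R using R by (simp add: positive_op_def)
  define y where "y = S x - R x"
  have "S (S x) = R (R x)" "R (S x) = S (R x)"
    using eq comm by (simp_all add: fun_eq_iff)
  then have "S y + R y = 0"
    by (simp add: y_def S.diff R.diff)
  then have "S y \<bullet> y + R y \<bullet> y = 0"
    by (simp flip: inner_add_left)
  moreover have "0 \<le> S y \<bullet> y" "0 \<le> R y \<bullet> y"
    using S R by (auto simp: positive_op_def)
  ultimately have "S y = 0" "R y = 0"
    using positive_op_eq_0[OF S, of y] positive_op_eq_0[OF R, of y] by auto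
  have "y \<bullet> y = x \<bullet> (S y - R y)"
    using S R unfolding positive_op_def symmetric_op_def
    by (simp add: y_def S.diff R.diff inner_diff_left inner_diff_right)
  then have "y = 0"
    by (simp add: \<open>S y = 0\<close> \<open>R y = 0\<close>)
  then show "R x = S x"
    by (simp add: y_def)
qed

lemma
  fixes T :: "'a::{real_inner, complete_space} \<Rightarrow> 'a"
  assumes T: "positive_op T"
  shows positive_op_sqrt_op: "positive_op (sqrt_op T)"
    and sqrt_op_comp_sqrt_op: "sqrt_op T \<circ> sqrt_op T = T"
proof -
  obtain S where S: "positive_op S" "S \<circ> S = T"
    and comm: "\<And>D. bounded_linear D \<Longrightarrow> D \<circ> T = T \<circ> D \<Longrightarrow> D \<circ> S = S \<circ> D"
    by (rule positive_op_sqrt_exists[OF T]) blast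
  have "positive_op (sqrt_op T) \<and> sqrt_op T \<circ> sqrt_op T = T"
    unfolding sqrt_op_def
  proof (rule theI[where a = S])
    \<comment> \<open>Any root \<open>R\<close> commutes with \<open>T = R \<circ> R\<close>, hence
      with the constructed \<open>S\<close>, so the commuting case of uniqueness applies.\<close>
    fix R assume R: "positive_op R \<and> R \<circ> R = T"
    then have "R \<circ> T = T \<circ> R"
      by (auto simp: comp_assoc)
    with R have "R \<circ> S = S \<circ> R"
      by (intro comm) (simp_all add: positive_op_def)
    then show "R = S"
      using R S by (intro positive_op_sqrt_unique_if_commute[of S R]) simp_all
  qed (use S in blast)
  then show "positive_op (sqrt_op T)" "sqrt_op T \<circ> sqrt_op T = T"
    by blast+
qed

section \<open>Finite-rank operators and their traces\<close>

text \<open>The vectors of \<open>C\<close> need not be normalised; a zero vector in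
  \<open>C\<close> is harmless, as its term is 0.\<close>

lemma orthogonal_projection_residual:
  assumes "finite C" "pairwise orthogonal C" "c \<in> C"
  shows "(x - (\<Sum>b\<in>C. ((x \<bullet> b) / (b \<bullet> b)) *\<^sub>R b)) \<bullet> c = 0"
proof -
  have "(\<Sum>b\<in>C. (x \<bullet> b) / (b \<bullet> b) * (b \<bullet> c))
      = (\<Sum>b\<in>C. if b = c then x \<bullet> c else 0)"
    using assms by (intro sum.cong) (auto simp: pairwise_def orthogonal_def)
  also have "\<dots> = x \<bullet> c"
    using assms by simp
  finally show ?thesis
    by (simp add: inner_diff_left inner_sum_left)
qed

text \<open>Bessel's inequality and best approximation: the projection \<open>p\<close> of
  \<open>v\<close> has squared norm equal to the sum and is the point of \<open>span F\<close>
  nearest to \<open>v\<close>. Together the bounds squeeze the partial sums in Parseval's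
  identity.\<close>

lemma orthonormal_projection_bounds:
  assumes F: "finite F" "pairwise orthogonal F" "\<And>e. e \<in> F \<Longrightarrow> norm e = 1" and w: "w \<in> span F"
  shows "(\<Sum>e\<in>F. (v \<bullet> e)\<^sup>2) \<le> (norm v)\<^sup>2"
    and "(norm v)\<^sup>2 - (\<Sum>e\<in>F. (v \<bullet> e)\<^sup>2) \<le> (norm (v - w))\<^sup>2"
proof -
  define p where "p = (\<Sum>e\<in>F. (v \<bullet> e) *\<^sub>R e)"
  have "p = (\<Sum>e\<in>F. ((v \<bullet> e) / (e \<bullet> e)) *\<^sub>R e)"
    unfolding p_def by (intro sum.cong refl) (simp add: F(3) power2_norm_eq_inner[symmetric])
  then have "(v - p) \<bullet> e = 0" if "e \<in> F" for e
    using orthogonal_projection_residual[OF F(1,2) that, of v] by simp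
  then have orth: "(v - p) \<bullet> y = 0" if "y \<in> span F" for y
    using orthogonal_to_span[OF that, of "v - p"] by (simp add: orthogonal_def)
  have p: "p \<in> span F"
    unfolding p_def by (intro span_sum span_scale span_base)
  have pp: "p \<bullet> p = (\<Sum>e\<in>F. (v \<bullet> e)\<^sup>2)"
  proof -
    have "p \<bullet> p = v \<bullet> p"
      using orth[OF p] by (simp add: inner_diff_left)
    then show ?thesis
      by (simp add: p_def inner_sum_right power2_eq_square)
  qed
  have vv: "v \<bullet> v = (v - p) \<bullet> (v - p) + p \<bullet> p"
    using orth[OF p] by (simp add: inner_diff_left inner_diff_right inner_commute)
  then show "(\<Sum>e\<in>F. (v \<bullet> e)\<^sup>2) \<le> (norm v)\<^sup>2"
    by (simp add: power2_norm_eq_inner pp)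
  have "(v - w) \<bullet> (v - w) = (v - p) \<bullet> (v - p) + 2 * ((v - p) \<bullet> (p - w)) + (p - w) \<bullet> (p - w)"
    by (simp add: inner_diff_left inner_diff_right inner_commute)
  moreover have "(v - p) \<bullet> (p - w) = 0"
    by (intro orth span_diff p w)
  ultimately show "(norm v)\<^sup>2 - (\<Sum>e\<in>F. (v \<bullet> e)\<^sup>2) \<le> (norm (v - w))\<^sup>2"
    by (simp add: power2_norm_eq_inner pp vv)
qed

lemma parseval_norm:
  assumes B: "orthonormal_basis B"
  shows "((\<lambda>e. (v \<bullet> e)\<^sup>2) has_sum (norm v)\<^sup>2) B"
  unfolding has_sum_def
proof (rule tendstoI)
  fix \<epsilon> :: real assume "0 < \<epsilon>"
  have orth: "pairwise orthogonal B" and unit: "\<And>e. e \<in> B \<Longrightarrow> norm e = 1"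
    and dense: "v \<in> closure (span B)"
    using B by (auto simp: orthonormal_basis_def)
  \<comment> \<open>The radius is \<open>sqrt \<epsilon>\<close> because the best-approximation
    bound squares the distance.\<close>
  obtain w where w: "w \<in> span B" "dist w v < sqrt \<epsilon>"
    using dense \<open>0 < \<epsilon>\<close> unfolding closure_approachable by (meson real_sqrt_gt_zero)
  then obtain F0 r where F0: "finite F0" "F0 \<subseteq> B" "w = (\<Sum>a\<in>F0. r a *\<^sub>R a)"
    unfolding span_explicit by blast
  have "dist (\<Sum>e\<in>F. (v \<bullet> e)\<^sup>2) ((norm v)\<^sup>2) < \<epsilon>" if F: "finite F" "F0 \<subseteq> F" "F \<subseteq> B" for F
  proof -
    have "w \<in> span F"
      unfolding F0(3) using F by (intro span_sum span_scale span_base) auto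
    note bounds = orthonormal_projection_bounds[OF F(1) pairwise_subset[OF orth F(3)] unit this,
        of v, OF subsetD[OF F(3)]]
    have "(norm (v - w))\<^sup>2 < (sqrt \<epsilon>)\<^sup>2"
      using w(2) by (intro power_strict_mono) (auto simp: dist_norm norm_minus_commute)
    then have "(norm (v - w))\<^sup>2 < \<epsilon>"
      using \<open>0 < \<epsilon>\<close> by simp
    with bounds show ?thesis
      by (auto simp: dist_real_def)
  qed
  then show "\<forall>\<^sub>F F in finite_subsets_at_top B. dist (\<Sum>e\<in>F. (v \<bullet> e)\<^sup>2) ((norm v)\<^sup>2) < \<epsilon>"
    unfolding eventually_finite_subsets_at_top using F0 by blast
qed

text \<open>Polarisation of the norm identity.\<close>

lemma parseval:
  assumes B: "orthonormal_basis B"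
  shows "((\<lambda>e. (u \<bullet> e) * (v \<bullet> e)) has_sum u \<bullet> v) B"
proof -
  have "((\<lambda>e. (((u + v) \<bullet> e)\<^sup>2 + - ((u - v) \<bullet> e)\<^sup>2) * (1/4))
      has_sum ((norm (u + v))\<^sup>2 + - (norm (u - v))\<^sup>2) * (1/4)) B"
    by (intro has_sum_cmult_left has_sum_add has_sum_uminusI parseval_norm B)
  moreover have "(((u + v) \<bullet> e)\<^sup>2 + - ((u - v) \<bullet> e)\<^sup>2) * (1/4) = (u \<bullet> e) * (v \<bullet> e)" for e
    by (simp add: inner_simps power2_eq_square algebra_simps)
  moreover have "((norm (u + v))\<^sup>2 + - (norm (u - v))\<^sup>2) * (1/4) = u \<bullet> v"
    by (simp add: power2_norm_eq_inner inner_simps inner_commute algebra_simps)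
  ultimately show ?thesis by simp
qed

lemma finite_rank_diagonal_has_sum:
  assumes "finite I" and B: "orthonormal_basis B"
    and A: "\<And>x. A x = (\<Sum>i\<in>I. (x \<bullet> u i) *\<^sub>R v i)"
  shows "((\<lambda>e. A e \<bullet> e) has_sum (\<Sum>i\<in>I. u i \<bullet> v i)) B"
proof -
  have "((\<lambda>e. \<Sum>i\<in>I. (u i \<bullet> e) * (v i \<bullet> e)) has_sum (\<Sum>i\<in>I. u i \<bullet> v i)) B"
    using \<open>finite I\<close> by induction (auto intro!: has_sum_add parseval B)
  then show ?thesis
    by (simp add: A inner_sum_left inner_commute[of _ "u _"])
qed

text \<open>The given basis makes the description in \<open>trace_op\<close> definite: were there no
  orthonormal basis, every \<open>t\<close> would satisfy it vacuously.\<close>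

lemma trace_op_finite_rank:
  fixes A :: "'a::real_inner \<Rightarrow> 'a" and B :: "'a set"
  assumes "finite I" and B: "orthonormal_basis B"
    and A: "\<And>x. A x = (\<Sum>i\<in>I. (x \<bullet> u i) *\<^sub>R v i)"
  shows "trace_op A = (\<Sum>i\<in>I. u i \<bullet> v i)"
  unfolding trace_op_def
proof (rule the_equality)
  show "\<forall>B. orthonormal_basis B \<longrightarrow> ((\<lambda>e. A e \<bullet> e) has_sum (\<Sum>i\<in>I. u i \<bullet> v i)) B"
    using finite_rank_diagonal_has_sum[OF \<open>finite I\<close> _ A] by blast
  show "t = (\<Sum>i\<in>I. u i \<bullet> v i)"
    if "\<forall>B. orthonormal_basis B \<longrightarrow> ((\<lambda>e. A e \<bullet> e) has_sum t) B" for t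
    using has_sum_unique that B finite_rank_diagonal_has_sum[OF \<open>finite I\<close> B A] by blast
qed

lemma bounded_linear_finite_rank:
  assumes A: "\<And>x. A x = (\<Sum>i\<in>I. (x \<bullet> u i) *\<^sub>R v i)"
  shows "bounded_linear A"
proof -
  have "bounded_linear (\<lambda>x. \<Sum>i\<in>I. (x \<bullet> u i) *\<^sub>R v i)"
    by (intro bounded_linear_sum bounded_linear_scaleR_const bounded_linear_inner_left)
  then show ?thesis by (simp add: A[abs_def])
qed

lemma abs_op_properties:
  fixes A :: "'a::{real_inner, complete_space} \<Rightarrow> 'a"
  assumes A: "bounded_linear A"
  shows positive_op_abs_op: "positive_op (abs_op A)"
    and norm_abs_op: "norm (abs_op A x) = norm (A x)"
proof -
  note P = positive_op_adjoint_comp[OF A]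
  show pos: "positive_op (abs_op A)"
    unfolding abs_op_def by (rule positive_op_sqrt_op[OF P])
  have "abs_op A (abs_op A x) = adjoint A (A x)"
    unfolding abs_op_def using sqrt_op_comp_sqrt_op[OF P] by (simp add: fun_eq_iff)
  then have "abs_op A x \<bullet> abs_op A x = A x \<bullet> A x"
    using pos inner_adjoint[OF A, of x "A x"] by (simp add: positive_op_def symmetric_op_def)
  then show "norm (abs_op A x) = norm (A x)"
    by (simp add: norm_eq_sqrt_inner)
qed

text \<open>\<open>abs_op A\<close> is itself of finite rank: it is determined by its values on an
  orthogonal family \<open>C\<close> spanning the same space as the \<open>u i\<close>, so the
  diagonal sum formula applies to it. \<open>C\<close> is not normalised, whence the factors
  \<open>1 / (c \<bullet> c)\<close>.\<close>

lemma trace_class_finite_rank: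
  fixes A :: "'a::{real_inner, complete_space} \<Rightarrow> 'a" and B :: "'a set"
  assumes "finite I" and B: "orthonormal_basis B"
    and A: "\<And>x. A x = (\<Sum>i\<in>I. (x \<bullet> u i) *\<^sub>R v i)"
  shows "trace_class A"
proof -
  have AL: "bounded_linear A"
    by (rule bounded_linear_finite_rank[OF A])
  interpret S: bounded_linear "abs_op A"
    using positive_op_abs_op[OF AL] by (simp add: positive_op_def)
  obtain C where C: "finite C" "pairwise orthogonal C" "span C = span (u ` I)"
    using basis_orthogonal[of "u ` I"] \<open>finite I\<close> by blast
  \<comment> \<open>\<open>\<bar>A\<bar>\<close> vanishes wherever \<open>A\<close> does, in particular on the orthogonal complement of the \<open>u i\<close>.\<close>
  have "abs_op A x = (\<Sum>c\<in>C. (x \<bullet> c) *\<^sub>R ((1 / (c \<bullet> c)) *\<^sub>R abs_op A c))" for x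
  proof -
    define y where "y = x - (\<Sum>c\<in>C. ((x \<bullet> c) / (c \<bullet> c)) *\<^sub>R c)"
    have "y \<bullet> c = 0" if "c \<in> C" for c
      unfolding y_def by (rule orthogonal_projection_residual[OF C(1,2) that])
    then have "y \<bullet> u i = 0" if "i \<in> I" for i
      using orthogonal_to_span[of "u i" C y] C(3) span_base[of "u i" "u ` I"] that
      by (simp add: orthogonal_def)
    then have "A y = 0"
      by (simp add: A)
    then have "abs_op A y = 0"
      using norm_abs_op[OF AL, of y] by simp
    then show ?thesis
      by (simp add: y_def S.diff S.sum S.scaleR)
  qed
  from finite_rank_diagonal_has_sum[OF C(1) B this]
  show ?thesis
    using AL B by (auto simp: trace_class_def has_sum_imp_summable)
qed

section \<open>The posterior covariance\<close>

text \<open>\<open>matrix_inv\<close> is a choice of two-sided inverse;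
  \<open>\<tau> *\<^sub>R mat 1\<close> witnesses that one exists, and the inverse equation then
  determines its action.\<close>

lemma misfit_op_scaled_mat:
  fixes H :: "'a::real_inner \<Rightarrow> real ^ 'd"
  assumes "\<tau> > 0"
  shows "misfit_op H (inverse \<tau> *\<^sub>R mat 1) = adjoint H \<circ> (\<lambda>y. \<tau> *\<^sub>R y) \<circ> H"
proof -
  let ?G = "inverse \<tau> *\<^sub>R mat 1 :: real^'d^'d"
  have "?G ** (\<tau> *\<^sub>R mat 1) = mat 1 \<and> (\<tau> *\<^sub>R mat 1) ** ?G = mat 1"
    using assms by (simp add: scalar_matrix_assoc[symmetric] matrix_scalar_ac)
  then have "?G ** matrix_inv ?G = mat 1 \<and> matrix_inv ?G ** ?G = mat 1"
    unfolding matrix_inv_def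
    by (rule someI[where P = "\<lambda>A'. ?G ** A' = mat 1 \<and> A' ** ?G = mat 1"])
  then have "?G *v (matrix_inv ?G *v y) = y" for y
    by (simp add: matrix_vector_mul_assoc)
  then have inv_scale: "inverse \<tau> *\<^sub>R (matrix_inv ?G *v y) = y" for y
    by (simp add: scaleR_matrix_vector_assoc[symmetric])
  have "matrix_inv ?G *v y = \<tau> *\<^sub>R y" for y
  proof -
    have "matrix_inv ?G *v y = \<tau> *\<^sub>R (inverse \<tau> *\<^sub>R (matrix_inv ?G *v y))"
      using assms by simp
    then show ?thesis
      by (simp only: inv_scale)
  qed
  then show ?thesis
    by (simp only: misfit_op_def)
qed

text \<open>Replaces an identity between partial inverses by one between everywhere defined maps. At
  the point \<open>T x\<close> equality of domains puts \<open>T x\<close> into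
  \<open>range C\<close>, so \<open>C\<close> can be applied to both sides.\<close>

lemma inverse_op_eq_add_op_inverse_op:
  fixes T C :: "'a::real_vector \<Rightarrow> 'a"
  assumes "inj T" "inj C"
    and eq: "inverse_op T = add_op A (inverse_op C)"
  shows "T x = C (x - A (T x))"
proof -
  have "Some x = add_op A (inverse_op C) (T x)"
    unfolding eq[symmetric] using \<open>inj T\<close> by (simp add: inverse_op_def)
  then have "T x \<in> range C" "x = A (T x) + inv C (T x)"
    by (auto simp: add_op_def inverse_op_def split: if_splits)
  then have "x - A (T x) = inv C (T x)"
    by (simp add: algebra_simps)
  then show ?thesis
    using \<open>T x \<in> range C\<close> by (simp add: f_inv_into_f)
qed

lemma positive_definite_op_inj:
  assumes "positive_definite_op C" "linear C"
  shows "inj C"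
proof -
  have "x = 0" if "C x = 0" for x
    using assms(1) that by (force simp: positive_definite_op_def)
  then show ?thesis
    using linear_injective_0[OF assms(2)] by blast
qed

text \<open>Finiteness of the traces is stated as membership of both operators in the trace class.
  The equation for \<open>Cv\<close> is one of partial maps, so it fixes the domain as well as the
  values.\<close>

theorem theorem2p5:
  fixes H :: "'a::{real_inner, complete_space} \<Rightarrow> real ^ 'd"
    and \<Gamma> :: "real ^ 'd ^ 'd"
    and C0 Cv :: "'a \<Rightarrow> 'a"
    and \<tau> lam C_lam :: real
  assumes "separable_space (euclidean :: 'a topology)"
    and "bounded_linear H"
    and "hilbert_schmidt (adjoint H \<circ> H)"
    and "\<tau> > 0"
    and "\<Gamma> = inverse \<tau> *\<^sub>R mat 1"
    and "positive_definite_op C0" and "symmetric_op C0" and "trace_class C0"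
    and "C_lam \<ge> 0"
    and "bounded_linear Cv" and "inj Cv"
    and "inverse_op Cv = add_op (\<lambda>x. (C_lam + lam\<^sup>2) *\<^sub>R misfit_op H \<Gamma> x) (inverse_op C0)"
  shows "trace_class (Cv \<circ> misfit_op H \<Gamma>)
    \<and> trace_class
         (inv (\<lambda>x. (C_lam + lam\<^sup>2) *\<^sub>R (sqrt_op C0 \<circ> misfit_op H \<Gamma> \<circ> sqrt_op C0) x + x)
            \<circ> (sqrt_op C0 \<circ> misfit_op H \<Gamma> \<circ> sqrt_op C0))
    \<and> trace_op (Cv \<circ> misfit_op H \<Gamma>)
       = trace_op
           (inv (\<lambda>x. (C_lam + lam\<^sup>2) *\<^sub>R (sqrt_op C0 \<circ> misfit_op H \<Gamma> \<circ> sqrt_op C0) x + x)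
              \<circ> (sqrt_op C0 \<circ> misfit_op H \<Gamma> \<circ> sqrt_op C0))"
proof -
  define a where "a = C_lam + lam\<^sup>2"
  have "0 \<le> a"
    using \<open>C_lam \<ge> 0\<close> by (simp add: a_def)
  define h where "h i = adjoint H i" for i
  define M where "M = misfit_op H \<Gamma>"
  define Q where "Q = sqrt_op C0"
  interpret H: bounded_linear H by fact
  interpret Cv: bounded_linear Cv by fact
  have M_eq: "M x = \<tau> *\<^sub>R adjoint H (H x)" for x
    using misfit_op_scaled_mat[OF \<open>\<tau> > 0\<close>, of H] \<open>\<Gamma> = _\<close>
      linear_scale[OF bounded_linear.linear[OF bounded_linear_adjoint[OF \<open>bounded_linear H\<close>]]]
    by (simp add: M_def)
  interpret M: bounded_linear M
    unfolding M_eq[abs_def]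
    by (intro bounded_linear_const_scaleR bounded_linear_compose[OF bounded_linear_adjoint]
        \<open>bounded_linear H\<close>)
  have M_inner: "M x \<bullet> x = \<tau> * (H x \<bullet> H x)" for x
    by (simp add: M_eq inner_commute[of "adjoint H _"] inner_adjoint[OF \<open>bounded_linear H\<close>])
  have M_sum: "M x = (\<Sum>b\<in>Basis. (x \<bullet> h b) *\<^sub>R (\<tau> *\<^sub>R h b))" for x
  proof -
    interpret H': bounded_linear "adjoint H"
      by (rule bounded_linear_adjoint[OF \<open>bounded_linear H\<close>])
    have "adjoint H (H x) = adjoint H (\<Sum>b\<in>Basis. (H x \<bullet> b) *\<^sub>R b)"
      by (simp add: euclidean_representation)
    also have "\<dots> = (\<Sum>b\<in>Basis. (x \<bullet> h b) *\<^sub>R h b)"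
      by (simp add: H'.sum H'.scaleR h_def inner_adjoint[OF \<open>bounded_linear H\<close>])
    finally show ?thesis
      by (simp add: M_eq scaleR_sum_right mult.commute)
  qed
  have C0: "bounded_linear C0" "positive_op C0"
    using \<open>trace_class C0\<close> \<open>symmetric_op C0\<close> \<open>positive_definite_op C0\<close>
    unfolding trace_class_def positive_op_def positive_definite_op_def
    by (auto, metis inner_zero_right less_imp_le order_refl)
  interpret C0: bounded_linear C0 by (rule C0(1))
  have Q_pos: "positive_op Q" and QQ: "Q (Q x) = C0 x" for x
    unfolding Q_def using positive_op_sqrt_op[OF C0(2)] sqrt_op_comp_sqrt_op[OF C0(2)]
    by (simp_all add: fun_eq_iff)
  then have Q_sym: "Q x \<bullet> y = x \<bullet> Q y" and QL: "bounded_linear Q" for x y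
    by (auto simp: positive_op_def symmetric_op_def)
  interpret Q: bounded_linear Q by (rule QL)
  \<comment> \<open>The definition of \<open>trace_class\<close> carries an orthonormal
    basis.\<close>
  obtain B :: "'a set" where B: "orthonormal_basis B"
    using \<open>trace_class C0\<close> by (auto simp: trace_class_def)
  have "inj C0"
    by (rule positive_definite_op_inj[OF \<open>positive_definite_op C0\<close> C0.linear_axioms])
  have Cv_eq: "Cv x + a *\<^sub>R C0 (M (Cv x)) = C0 x" for x
    using inverse_op_eq_add_op_inverse_op[OF \<open>inj Cv\<close> \<open>inj C0\<close> assms(12), of x]
    by (simp add: a_def M_def C0.diff C0.scaleR eq_diff_eq)
  define L where "L x = a *\<^sub>R Q (M (Q x)) + x" for x
  \<comment> \<open>The inverse of \<open>L\<close>, from \<open>R = Id - a Q M Q R\<close> (twice) and the expected \<open>Q R Q = Cv\<close>.\<close>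
  define R where "R x = x - a *\<^sub>R Q (M (Q x)) + a\<^sup>2 *\<^sub>R Q (M (Cv (M (Q x))))" for x
  have RL: "bounded_linear R"
    unfolding R_def
    by (intro bounded_linear_add bounded_linear_sub bounded_linear_ident
        bounded_linear_const_scaleR bounded_linear_compose[OF QL]
        bounded_linear_compose[OF M.bounded_linear_axioms]
        bounded_linear_compose[OF Cv.bounded_linear_axioms] QL)
  interpret R: bounded_linear R by (rule RL)
  have LR: "L (R x) = x" for x
  proof -
    define y where "y = M (Q x)"
    \<comment> \<open>Everything except \<open>x\<close> collects into the defect of
      \<open>Cv_eq\<close> at \<open>y\<close>.\<close>
    have "L (R x) = x + a\<^sup>2 *\<^sub>R Q (M (Cv y + a *\<^sub>R C0 (M (Cv y)) - C0 y))"
      by (simp add: L_def R_def Q.add Q.diff Q.scaleR M.add M.diff M.scaleR QQ y_def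
          scaleR_add_right scaleR_diff_right power2_eq_square power3_eq_cube algebra_simps)
    then show ?thesis
      by (simp add: Cv_eq Q.zero M.zero)
  qed
  \<comment> \<open>\<open>L\<close> dominates the identity because \<open>Q M Q\<close> is
    positive. With injectivity the right inverse \<open>R\<close> becomes the inverse of
    \<open>L\<close>.\<close>
  have inj: "x = y" if "L x = L y" for x y
  proof -
    define z where "z = x - y"
    have "L z = 0"
      using that by (simp add: z_def L_def Q.diff M.diff algebra_simps)
    then have "0 = L z \<bullet> z"
      by simp
    also have "\<dots> = a * (M (Q z) \<bullet> Q z) + z \<bullet> z"
      by (simp add: L_def inner_add_left Q_sym)
    also have "\<dots> \<ge> z \<bullet> z"
      using \<open>0 \<le> a\<close> \<open>\<tau> > 0\<close> by (simp add: M_inner)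
    finally have "z = 0"
      by (simp flip: power2_norm_eq_inner)
    then show ?thesis
      by (simp add: z_def)
  qed
  have inv_L: "inv L = R"
    by (rule inv_equality) (simp_all add: LR inj[OF LR])
  have Cv_QRQ: "Cv x = Q (R (Q x))" for x
  proof -
    \<comment> \<open>Both \<open>Cv x\<close> and \<open>Q (R (Q x))\<close> solve
      \<open>y + a *\<^sub>R C0 (M y) = C0 x\<close>. Pairing the homogeneous equation for their
      difference \<open>d\<close> with \<open>M d\<close> forces \<open>H d = 0\<close>, hence
      \<open>M d = 0\<close> and \<open>d = 0\<close>.\<close>
    define d where "d = Cv x - Q (R (Q x))"
    have "Q (R (Q x)) + a *\<^sub>R C0 (M (Q (R (Q x)))) = Q (L (R (Q x)))"
      by (simp add: L_def QQ Q.add Q.scaleR)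
    then have "d + a *\<^sub>R C0 (M d) = 0"
      using Cv_eq[of x] by (simp add: d_def LR QQ C0.diff M.diff algebra_simps)
    then have eq: "d = - (a *\<^sub>R C0 (M d))"
      by (simp add: eq_neg_iff_add_eq_0)
    have "M d \<bullet> d = - (a * (C0 (M d) \<bullet> M d))"
      by (subst (2) eq) (simp add: inner_commute)
    moreover have "0 \<le> a * (C0 (M d) \<bullet> M d)"
      using C0(2) \<open>0 \<le> a\<close> by (simp add: positive_op_def)
    ultimately have "\<tau> * (H d \<bullet> H d) \<le> 0"
      by (simp add: M_inner)
    then have "H d = 0"
      using \<open>\<tau> > 0\<close> by (simp add: mult_le_0_iff flip: power2_norm_eq_inner)
    then have "M d = 0"
      by (simp add: M_sum h_def inner_adjoint[OF \<open>bounded_linear H\<close>])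
    then have "d = 0"
      by (subst eq) (simp add: C0.zero)
    then show ?thesis
      by (simp add: d_def)
  qed
  have 1: "(Cv \<circ> M) x = (\<Sum>b\<in>Basis. (x \<bullet> h b) *\<^sub>R (\<tau> *\<^sub>R Q (R (Q (h b)))))" for x
    by (simp add: M_sum[of x] Cv.sum Cv.scaleR) (simp add: Cv_QRQ)
  have 2: "(R \<circ> (Q \<circ> M \<circ> Q)) x = (\<Sum>b\<in>Basis. (x \<bullet> Q (h b)) *\<^sub>R (\<tau> *\<^sub>R R (Q (h b))))" for x
    by (simp add: M_sum[of "Q x"] Q.sum Q.scaleR R.sum R.scaleR Q_sym)
  have "trace_class (Cv \<circ> M)" "trace_class (R \<circ> (Q \<circ> M \<circ> Q))"
    by (rule trace_class_finite_rank[OF finite_Basis B 1],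
        rule trace_class_finite_rank[OF finite_Basis B 2])
  moreover have "trace_op (Cv \<circ> M) = trace_op (R \<circ> (Q \<circ> M \<circ> Q))"
    unfolding trace_op_finite_rank[OF finite_Basis B 1] trace_op_finite_rank[OF finite_Basis B 2]
    by (simp add: Q_sym)
  moreover have "(\<lambda>x. (C_lam + lam\<^sup>2) *\<^sub>R (sqrt_op C0 \<circ> misfit_op H \<Gamma> \<circ> sqrt_op C0) x + x) = L"
    by (simp add: L_def a_def Q_def M_def fun_eq_iff)
  ultimately show ?thesis
    unfolding inv_L[symmetric] by (simp add: M_def Q_def)
qed

end
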